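(* Let $a,b,c,d\ge0$, not all zero, with $a+c=b+d$, and let $O=(e(i,t))_{i\in\mathbb Z,t\in\mathbb N}\sim\mathcal L\left(\mathrm{PM}(1/2);\frac{a}{a+c},\frac{b}{b+d}\right)$. Let $N\ge1$ and let $\overline S_N$ be any copy of $\overline K_N$ inside $\overline K_\infty$, i.e. the translate of $\overline K_N$ by some $(i_0,t_0)\in\mathbb Z\times\mathbb N$ with $i_0+t_0$ even. Then the restriction of $O$ to the edges of $\overline S_N$, i.e. $(e(i_0+i,t_0+t))_{(i,t)\in\overline E_N}$, where $\overline E_N$ is the edge set of $\overline K_N$, is distributed according to $\overline P^8_N$.
   Context: $\mathbb N=\{0,1,2,\dots\}$. Infinite graph $\overline K_\infty$ (square lattice rotated by $45$ degrees, on a half plane): edges are indexed by $(i,t)\in\mathbb Z\times\mathbb N$ ($t$ increases downwards); internal vertices are indexed by the pairs $(i,t)\in\mathbb Z\times\mathbb N$ with $i+t$ even, and the vertex $(i,t)$ is incident to the four edges $(i,t)$ (upper left), $(i+1,t)$ (upper right), $(i,t+1)$ (lower left), $(i+1,t+1)$ (lower right). An orientation of the edges is encoded by $e(i,t)=1$ if edge $(i,t)$ is oriented upwards, $e(i,t)=0$ if downwards. The law $\mathcal L(\mu;p,r)$, for $\mu$ a probability measure on $\{0,1\}^{\mathbb Z}$ and $p,r\in[0,1]$: $(e(i,0))_{i\in\mathbb Z}\sim\mu$; and $(e(\cdot,t))_{t\ge0}$ is a Markov chain such that, given line $t$, independently for all $i\in\mathbb Z$ with $i+t$ even, the pair $(e(i,t+1),e(i+1,t+1))$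 depends only on $(e(i,t),e(i+1,t))$, with, for $k\in\{0,1\}$: $(k,k)\mapsto(k,k)$ with probability $r$ and $(k,k)\mapsto(1-k,1-k)$ with probability $1-r$; $(k,1-k)\mapsto(1-k,k)$ with probability $p$ and $(k,1-k)\mapsto(k,1-k)$ with probability $1-p$. $\mathrm{PM}(1/2)$ is the law of i.i.d. Bernoulli$(1/2)$ variables indexed by $\mathbb Z$. Finite graph $\overline K_N$: its internal vertices are the pairs $(i,t)$ with $0\le t\le N-1$, $t\le i\le 2N-2-t$, $i+t$ even, with the same incidence rule; its edge set is $\overline E_N=\{(i,0):0\le i\le 2N-1\}\cup\bigcup_{t=0}^{N-1}\{(i,t+1):t\le i\le2N-1-t\}$. $\overline\Omega^8_N$ is the set of orientations of $\overline K_N$ with an even number of incoming edges at each vertex. The local weight of the vertex $(i,t)$ is, for $k\in\{0,1\}$, according to $\big((e(i,t),e(i+1,t)),(e(i,t+1),e(i+1,t+1))\big)$: $a$ for $((k,1-k),(1-k,k))$; $b$ for $((k,k),(k,k))$; $c$ for $((k,1-k),(k,1-k))$; $d$ for $((k,k),(1-k,1-k))$. $W(O)$ is the product of the local weights over vertices and $\overline P^8_N(O)=W(O)/\sum_{O'\in\overline\Omega^8_N}W(O')$ (8-vertex model with free boundary condition). *)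

theory Defs
  imports "HOL-Probability.Probability"
begin

text \<open>
  An orientation assigns to the edge indexed by \<open>(i, t)\<close> the value \<open>True\<close> (the paper's \<open>1\<close>) if the
  edge is oriented upwards, and \<open>False\<close> (\<open>0\<close>) if it is oriented downwards; \<open>t\<close> increases downwards.
\<close>

subsection \<open>The law of the random orientation of the infinite graph\<close>

type_synonym line = "int \<Rightarrow> bool"

definition line_space :: "line measure" where
  "line_space = PiM UNIV (\<lambda>_. count_space UNIV)"

definition orientation_space :: "(int \<times> nat \<Rightarrow> bool) measure" where
  "orientation_space = PiM UNIV (\<lambda>_. count_space UNIV)"

definition PM_half :: "line measure" where
  "PM_half = PiM UNIV (\<lambda>_. measure_pmf (bernoulli_pmf (1/2)))"

definition local_transition :: "real \<Rightarrow> real \<Rightarrow> bool \<times> bool \<Rightarrow> (bool \<times> bool) pmf" where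
  "local_transition p r = (\<lambda>(u, v).
     if u = v then map_pmf (\<lambda>keep. if keep then (u, v) else (\<not> u, \<not> v)) (bernoulli_pmf r)
     else map_pmf (\<lambda>swap. if swap then (v, u) else (u, v)) (bernoulli_pmf p))"

text \<open>
  Conditional law of line \<open>t + 1\<close> given that line \<open>t\<close> is \<open>x\<close>. The independent pairs are indexed by
  the \<open>i\<close> with \<open>i + t\<close> even, and the pair of index \<open>i\<close> is placed at the positions \<open>i\<close>, \<open>i + 1\<close>.
\<close>

definition vertices_on_line :: "nat \<Rightarrow> int set" where
  "vertices_on_line t = {i. even (i + int t)}"

definition line_of_pairs :: "nat \<Rightarrow> (int \<Rightarrow> bool \<times> bool) \<Rightarrow> line" where
  "line_of_pairs t w = (\<lambda>j. if j \<in> vertices_on_line t then fst (w j) else snd (w (j - 1)))"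

definition line_kernel :: "real \<Rightarrow> real \<Rightarrow> nat \<Rightarrow> line \<Rightarrow> line measure" where
  "line_kernel p r t x =
     distr (PiM (vertices_on_line t) (\<lambda>i. measure_pmf (local_transition p r (x i, x (i + 1)))))
       line_space (line_of_pairs t)"

text \<open>
  Conditional law of line \<open>n\<close> given the lines \<open>0, \<dots>, n - 1\<close>, in the form required by the
  Ionescu-Tulcea theorem.
\<close>

definition chain_kernel ::
  "line measure \<Rightarrow> real \<Rightarrow> real \<Rightarrow> nat \<Rightarrow> (nat \<Rightarrow> line) \<Rightarrow> line measure" where
  "chain_kernel \<mu> p r n x = (case n of 0 \<Rightarrow> \<mu> | Suc t \<Rightarrow> line_kernel p r t (x t))"

definition chain_law :: "line measure \<Rightarrow> real \<Rightarrow> real \<Rightarrow> (nat \<Rightarrow> line) measure" where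
  "chain_law \<mu> p r =
     projective_family.lim UNIV (Ionescu_Tulcea.CI (chain_kernel \<mu> p r) (\<lambda>_. line_space))
       (\<lambda>_. line_space)"

definition law_L :: "line measure \<Rightarrow> real \<Rightarrow> real \<Rightarrow> (int \<times> nat \<Rightarrow> bool) measure" where
  "law_L \<mu> p r = distr (chain_law \<mu> p r) orientation_space (\<lambda>x (i, t). x t i)"

lemma space_line_space [simp]: "space line_space = UNIV"
  by (simp add: line_space_def space_PiM)

lemma measurable_line_of_pairs:
  "line_of_pairs t \<in> measurable (PiM (vertices_on_line t) (\<lambda>i. measure_pmf (q i))) line_space"
  unfolding line_space_def
proof (rule measurable_PiM_single')
  fix j :: int
  let ?M = "PiM (vertices_on_line t) (\<lambda>i. measure_pmf (q i))"
  show "(\<lambda>w. line_of_pairs t w j) \<in> measurable ?M (count_space UNIV)"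
  proof (cases "j \<in> vertices_on_line t")
    case True
    have "(\<lambda>w. w j) \<in> measurable ?M (measure_pmf (q j))"
      using True by (rule measurable_component_singleton)
    from measurable_compose[OF this, of fst "count_space UNIV"] True
    show ?thesis by (simp add: line_of_pairs_def)
  next
    case False
    then have j: "j - 1 \<in> vertices_on_line t" by (auto simp: vertices_on_line_def)
    then have "(\<lambda>w. w (j - 1)) \<in> measurable ?M (measure_pmf (q (j - 1)))"
      by (rule measurable_component_singleton)
    from measurable_compose[OF this, of snd "count_space UNIV"] False
    show ?thesis by (simp add: line_of_pairs_def)
  qed
qed (auto simp: space_PiM)

lemma prob_space_line_kernel: "prob_space (line_kernel p r t x)"
  unfolding line_kernel_def
  by (intro prob_space.prob_space_distr measurable_line_of_pairs prob_space_PiM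
        measure_pmf.prob_space_axioms)

lemma measurable_line_kernel:
  "line_kernel p r t \<in> measurable line_space (subprob_algebra line_space)"
proof -
  define I where "I = vertices_on_line t"
  define N where "N = PiM I (\<lambda>_. count_space UNIV :: (bool \<times> bool) measure)"
  define K where "K x = PiM I (\<lambda>i. measure_pmf (local_transition p r (x i, x (i + 1))))"
    for x :: line
  have sets_K: "sets (K x) = sets N" for x
    unfolding K_def N_def by (intro sets_PiM_cong) auto
  have prob_K: "prob_space (K x)" for x
    unfolding K_def by (intro prob_space_PiM measure_pmf.prob_space_axioms)
  have "K \<in> measurable line_space (prob_algebra N)"
  proof (rule measurable_prob_algebra_generated)
    show "sets N = sigma_sets (space N) (prod_algebra I (\<lambda>_. count_space UNIV))"
      unfolding N_def by (simp add: sets_PiM space_PiM)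
    show "Int_stable (prod_algebra I (\<lambda>_. count_space UNIV :: (bool \<times> bool) measure))"
      by (rule Int_stable_prod_algebra)
    show "prod_algebra I (\<lambda>_. count_space UNIV) \<subseteq> Pow (space N)"
      unfolding N_def space_PiM by (rule prod_algebra_sets_into_space)
  next
    fix A assume "A \<in> prod_algebra I (\<lambda>_. count_space UNIV :: (bool \<times> bool) measure)"
    then obtain J E where J: "finite J" "J \<subseteq> I"
      and A: "A = prod_emb I (\<lambda>_. count_space UNIV) J (\<Pi>\<^sub>E j\<in>J. E j)"
      by (rule prod_algebraE) auto
    have coord: "(\<lambda>x. x i) \<in> measurable line_space (count_space UNIV)" for i
      unfolding line_space_def by (rule measurable_component_singleton) simp
    have "(\<lambda>x::line. (x i, x (i + 1))) \<in> measurable line_space (count_space UNIV \<Otimes>\<^sub>M count_space UNIV)"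
      for i by (intro measurable_Pair coord)
    then have pair: "(\<lambda>x::line. (x i, x (i + 1))) \<in> measurable line_space (count_space UNIV)" for i
      by (simp add: pair_measure_countable)
    have "emeasure (K x) A =
        (\<Prod>j\<in>J. emeasure (measure_pmf (local_transition p r (x j, x (j + 1)))) (E j))" for x
    proof -
      interpret product_prob_space "\<lambda>i. measure_pmf (local_transition p r (x i, x (i + 1)))" I
        by unfold_locales
      have "A = prod_emb I (\<lambda>i. measure_pmf (local_transition p r (x i, x (i + 1)))) J (\<Pi>\<^sub>E j\<in>J. E j)"
        by (simp add: A prod_emb_def)
      then show ?thesis
        unfolding K_def using emeasure_PiM_emb[OF J(2,1), of E] by simp
    qed
    moreover have "(\<lambda>x::line. \<Prod>j\<in>J. emeasure (measure_pmf (local_transition p r (x j, x (j + 1)))) (E j))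
        \<in> borel_measurable line_space"
      by (intro borel_measurable_prod_ennreal measurable_compose[OF pair]) simp
    ultimately show "(\<lambda>x. emeasure (K x) A) \<in> borel_measurable line_space"
      by simp
  qed (use sets_K prob_K in auto)
  then have K: "K \<in> measurable line_space (subprob_algebra N)"
    by (rule measurable_prob_algebraD)
  have "line_of_pairs t \<in> measurable N line_space"
    using measurable_line_of_pairs[of t "\<lambda>_. undefined"]
    by (subst measurable_cong_sets[of N "PiM I (\<lambda>_. measure_pmf undefined)", OF _ refl])
       (auto simp: N_def I_def intro!: sets_PiM_cong)
  then have "(\<lambda>x. distr (K x) line_space (line_of_pairs t)) \<in>
      measurable line_space (subprob_algebra line_space)"
    by (rule measurable_compose[OF K measurable_distr])
  then show ?thesis
    by (simp add: line_kernel_def[abs_def] K_def I_def)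
qed

text \<open>Hence the projective limit in \<^const>\<open>chain_law\<close> is the one given by the Ionescu-Tulcea theorem.\<close>

lemma Ionescu_Tulcea_chain:
  assumes "prob_space \<mu>" and "sets \<mu> = sets line_space"
  shows "Ionescu_Tulcea (chain_kernel \<mu> p r) (\<lambda>_. line_space)"
proof (rule Ionescu_Tulcea.intro)
  fix n :: nat
  show "chain_kernel \<mu> p r n \<in>
      measurable (PiM {0..<n} (\<lambda>_. line_space)) (subprob_algebra line_space)"
  proof (cases n)
    case 0
    have "\<mu> \<in> space (subprob_algebra line_space)"
      using assms by (simp add: space_subprob_algebra prob_space_imp_subprob_space)
    with 0 show ?thesis by (simp add: chain_kernel_def[abs_def])
  next
    case (Suc t)
    have "(\<lambda>x. x t) \<in> measurable (PiM {0..<n} (\<lambda>_. line_space)) line_space"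
      using Suc by (intro measurable_component_singleton) simp
    from measurable_compose[OF this measurable_line_kernel] Suc
    show ?thesis by (simp add: chain_kernel_def[abs_def])
  qed
  show "prob_space (chain_kernel \<mu> p r n x)" for x
    using assms(1) prob_space_line_kernel by (cases n) (auto simp: chain_kernel_def)
qed

subsection \<open>The 8-vertex model with free boundary condition\<close>

definition vertices_K :: "nat \<Rightarrow> (int \<times> nat) set" where
  "vertices_K N = {(i, t). t < N \<and> int t \<le> i \<and> i \<le> 2 * int N - 2 - int t \<and> even (i + int t)}"

definition edges_K :: "nat \<Rightarrow> (int \<times> nat) set" where
  "edges_K N = {(i, 0) | i. 0 \<le> i \<and> i \<le> 2 * int N - 1} \<union>
     (\<Union>t<N. {(i, t + 1) | i. int t \<le> i \<and> i \<le> 2 * int N - 1 - int t})"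

definition orientations_K :: "nat \<Rightarrow> (int \<times> nat \<Rightarrow> bool) set" where
  "orientations_K N = (edges_K N \<rightarrow>\<^sub>E UNIV)"

definition incoming_edges :: "(int \<times> nat \<Rightarrow> bool) \<Rightarrow> int \<times> nat \<Rightarrow> (int \<times> nat) set" where
  "incoming_edges e = (\<lambda>(i, t).
     {f \<in> {(i, t), (i + 1, t)}. \<not> e f} \<union> {f \<in> {(i, t + 1), (i + 1, t + 1)}. e f})"

definition Omega8 :: "nat \<Rightarrow> (int \<times> nat \<Rightarrow> bool) set" where
  "Omega8 N = {e \<in> orientations_K N. \<forall>v \<in> vertices_K N. even (card (incoming_edges e v))}"

text \<open>The value \<open>0\<close> is only taken at vertices with an odd number of incoming edges.\<close>

definition local_weight ::
  "real \<Rightarrow> real \<Rightarrow> real \<Rightarrow> real \<Rightarrow> (int \<times> nat \<Rightarrow> bool) \<Rightarrow> int \<times> nat \<Rightarrow> real" where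
  "local_weight a b c d e = (\<lambda>(i, t).
     let up = (e (i, t), e (i + 1, t)); low = (e (i, t + 1), e (i + 1, t + 1)) in
     if \<exists>k. up = (k, \<not> k) \<and> low = (\<not> k, k) then a
     else if \<exists>k. up = (k, k) \<and> low = (k, k) then b
     else if \<exists>k. up = (k, \<not> k) \<and> low = (k, \<not> k) then c
     else if \<exists>k. up = (k, k) \<and> low = (\<not> k, \<not> k) then d
     else 0)"

definition weight8 :: "real \<Rightarrow> real \<Rightarrow> real \<Rightarrow> real \<Rightarrow> nat \<Rightarrow> (int \<times> nat \<Rightarrow> bool) \<Rightarrow> real" where
  "weight8 a b c d N e = (\<Prod>v\<in>vertices_K N. local_weight a b c d e v)"

definition prob8 :: "real \<Rightarrow> real \<Rightarrow> real \<Rightarrow> real \<Rightarrow> nat \<Rightarrow> (int \<times> nat \<Rightarrow> bool) \<Rightarrow> real" where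
  "prob8 a b c d N e = weight8 a b c d N e / (\<Sum>e'\<in>Omega8 N. weight8 a b c d N e')"

text \<open>
  The 8-vertex measure, viewed as a measure on all orientations of the finite graph that gives
  no mass to the complement of \<^const>\<open>Omega8\<close>.
\<close>

definition P8 :: "real \<Rightarrow> real \<Rightarrow> real \<Rightarrow> real \<Rightarrow> nat \<Rightarrow> (int \<times> nat \<Rightarrow> bool) measure" where
  "P8 a b c d N = point_measure (orientations_K N)
     (\<lambda>e. if e \<in> Omega8 N then ennreal (prob8 a b c d N e) else 0)"

text \<open>
  Restriction of an orientation of the infinite graph to the copy of the finite graph translated
  by \<open>(i\<^sub>0, t\<^sub>0)\<close>, re-indexed by the edges of the finite graph.
\<close>

definition restrict_to_copy ::
  "nat \<Rightarrow> int \<Rightarrow> nat \<Rightarrow> (int \<times> nat \<Rightarrow> bool) \<Rightarrow> (int \<times> nat \<Rightarrow> bool)" where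
  "restrict_to_copy N i\<^sub>0 t\<^sub>0 e = (\<lambda>(i, t)\<in>edges_K N. e (i\<^sub>0 + i, t\<^sub>0 + t))"

end

theory Submission
  imports Defs
begin

text \<open>
  Every local transition is doubly stochastic on pairs of bits, so the pairs on the lower side of a
  row of vertices are again independent and uniform: \<open>PM(1/2)\<close> is stationary for the chain, and the
  top line of any copy of the finite graph is uniform. Given the lines above it, each further line
  of the copy has as conditional probability the product of local transition probabilities over the
  vertices just above it, and these probabilities are the local weights divided by \<open>a + c = b + d\<close>.
  Hence an orientation of the copy has probability proportional to its weight; the constant
  need not be computed, since both sides have total mass \<open>1\<close>.
\<close>

section \<open>One step of an Ionescu-Tulcea chain\<close>

text \<open>The joint probability is the integral of the kernel mass
  \<open>emeasure (P n x) B\<close> over the histories in \<open>A\<close>; this mass is the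
  constant \<open>q\<close> there, so the integral becomes a product.\<close>

lemma (in Ionescu_Tulcea) emeasure_lim_step:
  assumes A[measurable]: "A \<in> sets (PiM {0..<n} M)" and B[measurable]: "B \<in> sets (M n)"
    and q: "\<And>x. x \<in> A \<Longrightarrow> emeasure (P n x) B = q"
  shows "emeasure PF.lim {x \<in> space (PiM UNIV M). restrict x {0..<n} \<in> A \<and> x n \<in> B}
    = q * emeasure PF.lim {x \<in> space (PiM UNIV M). restrict x {0..<n} \<in> A}"
proof -
  define A' where "A' = {x \<in> space (PiM {0..<Suc n} M). restrict x {0..<n} \<in> A \<and> x n \<in> B}"
  have restr: "(\<lambda>x. restrict x {0..<n}) \<in> measurable (PiM {0..<Suc n} M) (PiM {0..<n} M)"
    by (rule measurable_restrict_subset) auto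
  have comp: "(\<lambda>x. x n) \<in> measurable (PiM {0..<Suc n} M) (M n)"
    by (rule measurable_component_singleton) simp
  have A'[measurable]: "A' \<in> sets (PiM {0..<Suc n} M)"
  proof -
    have "A' = ((\<lambda>x. restrict x {0..<n}) -` A \<inter> space (PiM {0..<Suc n} M)) \<inter>
        ((\<lambda>x. x n) -` B \<inter> space (PiM {0..<Suc n} M))"
      by (auto simp: A'_def)
    then show ?thesis
      using measurable_sets[OF restr A] measurable_sets[OF comp B] by simp
  qed
  have emb_id: "prod_emb J M J Z = Z" if "Z \<in> sets (PiM J M)" for J :: "nat set" and Z
    by (rule prod_emb_id) (use sets.sets_into_space[OF that] in \<open>auto simp: space_PiM\<close>)
  \<comment> \<open>The coordinates below \<open>m\<close> have law \<open>C 0 m\<close> started at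
    \<open>\<lambda>_. undefined\<close>, the only history of length \<open>0\<close>.\<close>
  have lim_emb: "emeasure PF.lim (prod_emb UNIV M {0..<m} Z) = emeasure (C 0 m (\<lambda>_. undefined)) Z"
    if "Z \<in> sets (PiM {0..<m} M)" for m Z
    using that by (simp add: lim emeasure_CI[of _ m] emb_id)
  have x0: "(\<lambda>_. undefined) \<in> space (PiM {0..<0} M)"
    by (simp add: space_PiM)
  have C_sets: "sets (C 0 n (\<lambda>_. undefined)) = sets (PiM {0..<n} M)"
    using sets_C[OF x0, of n] by simp
  then have C_space: "space (C 0 n (\<lambda>_. undefined)) = space (PiM {0..<n} M)"
    by (rule sets_eq_imp_space_eq)
  \<comment> \<open>\<open>eP n x\<close> appends to \<open>x\<close> a coordinate drawn from
    \<open>P n x\<close>, so \<open>A'\<close> pulls back to \<open>B\<close> if \<open>x\<close>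
    lies in \<open>A\<close> and to the empty set otherwise.\<close>
  have eP: "emeasure (eP n x) A' = q * indicator A x" if x: "x \<in> space (PiM {0..<n} M)" for x
  proof -
    have "restrict (x(n := y)) {0..<n} = x" for y
      using x by (auto simp: fun_eq_iff space_PiM PiE_iff extensional_def)
    moreover have "x(n := y) \<in> space (PiM {0..<Suc n} M)" if "y \<in> space (M n)" for y
      using x that by (auto simp: space_PiM PiE_iff extensional_def less_Suc_eq)
    moreover have "B \<subseteq> space (M n)"
      using B by (rule sets.sets_into_space)
    ultimately have "(\<lambda>y. x(n := y)) -` A' \<inter> space (M n) = (if x \<in> A then B else {})"
      by (auto simp: A'_def)
    then show ?thesis
      using q[of x] by (simp add: emeasure_eP[OF x A'])
  qed
  have "emeasure PF.lim {x \<in> space (PiM UNIV M). restrict x {0..<n} \<in> A \<and> x n \<in> B}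
      = emeasure PF.lim (prod_emb UNIV M {0..<Suc n} A')"
    by (intro arg_cong[where f="emeasure PF.lim"])
       (auto simp: prod_emb_def A'_def space_PiM restrict_restrict Int_absorb1 PiE_iff)
  also have "\<dots> = emeasure (C 0 (Suc n) (\<lambda>_. undefined)) A'"
    by (rule lim_emb) (rule A')
  also have "\<dots> = (\<integral>\<^sup>+x. emeasure (eP n x) A' \<partial>C 0 n (\<lambda>_. undefined))"
    using A' C_sets C_space
    by (simp, intro emeasure_bind[where N="PiM {0..<Suc n} M"])
       (auto cong: measurable_cong_sets)
  also have "\<dots> = (\<integral>\<^sup>+x. q * indicator A x \<partial>C 0 n (\<lambda>_. undefined))"
    using eP by (intro nn_integral_cong) (simp add: C_space)
  also have "\<dots> = q * emeasure (C 0 n (\<lambda>_. undefined)) A"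
    using A C_sets by (simp add: nn_integral_cmult_indicator)
  also have "emeasure (C 0 n (\<lambda>_. undefined)) A = emeasure PF.lim (prod_emb UNIV M {0..<n} A)"
    using A by (rule lim_emb[symmetric])
  also have "prod_emb UNIV M {0..<n} A = {x \<in> space (PiM UNIV M). restrict x {0..<n} \<in> A}"
    by (auto simp: prod_emb_def space_PiM)
  finally show ?thesis .
qed

section \<open>Local transitions and local weights\<close>

lemma pmf_local_transition:
  assumes "0 \<le> p" "p \<le> 1" "0 \<le> r" "r \<le> 1"
  shows "pmf (local_transition p r (u, v)) (u', v') =
    (if u = v then if u' = v' then if u' = u then r else 1 - r else 0
     else if u' \<noteq> v' then if u' = v then p else 1 - p else 0)"
proof -
  have "{x. x} = {True}" "Collect Not = {False}" by auto
  then show ?thesis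
    using assms
    by (cases u; cases v; cases u'; cases v')
       (simp_all add: local_transition_def map_pmf_def pmf_bind integral_measure_pmf_real[of UNIV] UNIV_bool)
qed

text \<open>An equal pair is reached from itself with probability \<open>r\<close> and from its
  complement with \<open>1 - r\<close>; an unequal pair from its swap with \<open>p\<close> and from
  itself with \<open>1 - p\<close>.\<close>

lemma local_transition_doubly_stochastic:
  assumes "0 \<le> p" "p \<le> 1" "0 \<le> r" "r \<le> 1"
  shows "(\<Sum>q\<in>UNIV. pmf (local_transition p r q) w) = 1"
proof -
  obtain u v where w: "w = (u, v)" by (cases w)
  have "(\<Sum>q\<in>UNIV. pmf (local_transition p r q) w) =
      (\<Sum>x\<in>UNIV. \<Sum>y\<in>UNIV. pmf (local_transition p r (x, y)) (u, v))"
    unfolding w by (simp add: sum.cartesian_product case_prod_beta)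
  then show ?thesis
    unfolding pmf_local_transition[OF assms] UNIV_bool by (cases u; cases v) simp_all
qed

text \<open>This nesting of cases mirrors \<open>pmf_local_transition\<close>, so that weights and
  probabilities can be compared branch by branch.\<close>

lemma local_weight_if:
  "local_weight a b c d e (i, t) =
    (if e (i, t) = e (i + 1, t)
     then if e (i, t + 1) = e (i + 1, t + 1) then if e (i, t + 1) = e (i, t) then b else d else 0
     else if e (i, t + 1) \<noteq> e (i + 1, t + 1) then if e (i, t + 1) = e (i + 1, t) then a else c else 0)"
proof -
  have "(if \<exists>k. (u, v) = (k, \<not> k) \<and> (u', v') = (\<not> k, k) then a
      else if \<exists>k. (u, v) = (k, k) \<and> (u', v') = (k, k) then b
      else if \<exists>k. (u, v) = (k, \<not> k) \<and> (u', v') = (k, \<not> k) then c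
      else if \<exists>k. (u, v) = (k, k) \<and> (u', v') = (\<not> k, \<not> k) then d else 0) =
    (if u = v then if u' = v' then if u' = u then b else d else 0
     else if u' \<noteq> v' then if u' = v then a else c else 0)" for u v u' v'
    by (unfold ex_bool_eq, cases u; cases v; cases u'; cases v'; simp)
  then show ?thesis
    by (simp only: local_weight_def prod.case Let_def)
qed

text \<open>The weights \<open>a\<close>, \<open>c\<close> of unequal upper pairs are normalised by
  \<open>a + c\<close>, and \<open>b\<close>, \<open>d\<close> of equal ones by
  \<open>b + d\<close>; the balance condition lets one factor serve every vertex.\<close>

lemma local_weight_eq_pmf:
  assumes "a \<ge> 0" "b \<ge> 0" "c \<ge> 0" "d \<ge> 0" "a + c = b + d" "a + c > 0"
  shows "local_weight a b c d e (i, t) = (a + c) *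
    pmf (local_transition (a / (a + c)) (b / (b + d)) (e (i, t), e (i + 1, t)))
      (e (i, t + 1), e (i + 1, t + 1))"
proof -
  have "0 \<le> a / (a + c)" "a / (a + c) \<le> 1" "0 \<le> b / (b + d)" "b / (b + d) \<le> 1"
    using assms by simp_all
  note pmf = pmf_local_transition[OF this]
  have "(a + c) * (1 - a / (a + c)) = c" "(a + c) * (1 - b / (b + d)) = d"
    "(a + c) * (a / (a + c)) = a" "(a + c) * (b / (b + d)) = b"
    using assms(5,6) by (simp_all add: right_diff_distrib)
  then show ?thesis
    unfolding local_weight_if pmf by simp
qed

text \<open>A nonzero weight requires the upper and lower pairs to be both equal or both unequal,
  which makes the number of incoming edges even.\<close>

lemma local_weight_odd:
  assumes "odd (card (incoming_edges e (i, t)))"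
  shows "local_weight a b c d e (i, t) = 0"
proof (rule ccontr)
  assume "local_weight a b c d e (i, t) \<noteq> 0"
  \<comment> \<open>The parity condition is solved for the fourth edge, leaving eight cases for the
    other three.\<close>
  then have *: "e (i + 1, t + 1) = (e (i, t + 1) = (e (i, t) = e (i + 1, t)))"
    unfolding local_weight_if by (auto split: if_splits)
  have split: "{f \<in> {x, y}. Q f} = (if Q x then {x} else {}) \<union> (if Q y then {y} else {})"
    for x y :: "int \<times> nat" and Q by auto
  show False
    using assms
    unfolding incoming_edges_def prod.case split *
    by (cases "e (i, t)"; cases "e (i + 1, t)"; cases "e (i, t + 1)") simp_all
qed

section \<open>Cylinder events\<close>

definition cylinder :: "(int \<times> nat) set \<Rightarrow> (int \<times> nat \<Rightarrow> bool) \<Rightarrow> (int \<times> nat \<Rightarrow> bool) set" where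
  "cylinder F e = {x. \<forall>f\<in>F. x f = e f}"

text \<open>For a set \<open>K\<close> of vertices on line \<open>t\<close>,
  \<open>pair_edges t K\<close> consists of their upper edges and
  \<open>pair_edges (Suc t) K\<close> of their lower edges.\<close>

definition pair_edges :: "nat \<Rightarrow> int set \<Rightarrow> (int \<times> nat) set" where
  "pair_edges t K = (K \<union> (\<lambda>i. i + 1) ` K) \<times> {t}"

lemma space_orientation_space [simp]: "space orientation_space = UNIV"
  by (simp add: orientation_space_def space_PiM)

lemma sets_PiM_cylinder:
  assumes "finite J" "J \<subseteq> I"
  shows "{x \<in> space (PiM I (\<lambda>_. count_space UNIV)). \<forall>j\<in>J. x j = y j}
    \<in> sets (PiM I (\<lambda>_. count_space UNIV))"
proof (rule sets.sets_Collect_finite_All[OF _ assms(1)])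
  fix j assume "j \<in> J"
  then have "(\<lambda>x. x j) \<in> measurable (PiM I (\<lambda>_. count_space UNIV)) (count_space UNIV)"
    using assms(2) by (intro measurable_component_singleton) auto
  from measurable_sets[OF this, of "{y j}"]
  show "{x \<in> space (PiM I (\<lambda>_. count_space UNIV)). x j = y j}
      \<in> sets (PiM I (\<lambda>_. count_space UNIV))"
    by (simp add: vimage_def Int_def conj_commute)
qed

lemma sets_cylinder:
  assumes "finite F"
  shows "cylinder F e \<in> sets orientation_space"
  using sets_PiM_cylinder[OF assms, of UNIV e]
  by (simp add: cylinder_def orientation_space_def space_PiM)

lemma sets_line_cylinder:
  assumes "finite J"
  shows "{z. \<forall>j\<in>J. z j = y j} \<in> sets line_space"
  using sets_PiM_cylinder[OF assms, of UNIV y]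
  by (simp add: line_space_def space_PiM)

lemma sets_line_pairs:
  assumes "finite K"
  shows "{z. \<forall>i\<in>K. (z i, z (i + 1)) = w i} \<in> sets line_space"
proof -
  have "{z. \<forall>i\<in>K. (z i, z (i + 1)) = w i} =
      {z. \<forall>i\<in>K. z i = fst (w i)} \<inter> {z. \<forall>j\<in>(\<lambda>i. i + 1) ` K. z j = snd (w (j - 1))}"
    by (auto simp: prod_eq_iff)
  then show ?thesis
    using assms by (simp only:) (intro sets.Int sets_line_cylinder finite_imageI)
qed

text \<open>For \<open>i\<close> of the parity of line \<open>t\<close>, the positions
  \<open>i\<close> and \<open>i + 1\<close> hold exactly the pair of index \<open>i\<close>; the
  event thus pulls back to a condition on independent coordinates.\<close>

lemma emeasure_line_kernel_pairs:
  assumes K: "finite K" "K \<subseteq> vertices_on_line t"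
  shows "emeasure (line_kernel p r t x) {z. \<forall>i\<in>K. (z i, z (i + 1)) = w i}
    = ennreal (\<Prod>i\<in>K. pmf (local_transition p r (x i, x (i + 1))) (w i))"
proof -
  let ?q = "\<lambda>i. local_transition p r (x i, x (i + 1))"
  let ?M = "PiM (vertices_on_line t) (\<lambda>i. measure_pmf (?q i))"
  interpret product_prob_space "\<lambda>i. measure_pmf (?q i)" "vertices_on_line t"
    by unfold_locales
  have pair: "(line_of_pairs t v i, line_of_pairs t v (i + 1)) = v i" if "i \<in> K" for i v
    using that K(2) by (auto simp: vertices_on_line_def line_of_pairs_def)
  have "emeasure (line_kernel p r t x) {z. \<forall>i\<in>K. (z i, z (i + 1)) = w i}
    = emeasure ?M (line_of_pairs t -` {z. \<forall>i\<in>K. (z i, z (i + 1)) = w i} \<inter> space ?M)"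
    unfolding line_kernel_def
    by (rule emeasure_distr[OF measurable_line_of_pairs sets_line_pairs[OF K(1)]])
  also have "line_of_pairs t -` {z. \<forall>i\<in>K. (z i, z (i + 1)) = w i} \<inter> space ?M
      = {v \<in> space ?M. \<forall>i\<in>K. v i \<in> {w i}}"
    unfolding vimage_def mem_Collect_eq using pair by (auto simp del: prod.inject)
  also have "emeasure ?M \<dots> = (\<Prod>i\<in>K. emeasure (measure_pmf (?q i)) {w i})"
    using K by (intro emeasure_PiM_Collect) auto
  finally show ?thesis by (simp add: emeasure_pmf_single prod_ennreal)
qed

lemma prob_space_PM_half: "prob_space PM_half"
  unfolding PM_half_def by (intro prob_space_PiM measure_pmf.prob_space_axioms)

lemma sets_PM_half: "sets PM_half = sets line_space"
  unfolding PM_half_def line_space_def by (intro sets_PiM_cong) auto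

lemma emeasure_PM_half_cylinder:
  assumes "finite J"
  shows "emeasure PM_half {z. \<forall>j\<in>J. z j = y j} = ennreal ((1 / 2) ^ card J)"
proof -
  interpret product_prob_space "\<lambda>_::int. measure_pmf (bernoulli_pmf (1 / 2))" UNIV
    by unfold_locales
  have "emeasure PM_half {z. \<forall>j\<in>J. z j = y j} =
      emeasure (PiM UNIV (\<lambda>_::int. measure_pmf (bernoulli_pmf (1 / 2))))
        {z \<in> space (PiM UNIV (\<lambda>_::int. measure_pmf (bernoulli_pmf (1 / 2)))). \<forall>j\<in>J. z j \<in> {y j}}"
    by (simp add: PM_half_def space_PiM)
  also have "\<dots> = (\<Prod>j\<in>J. emeasure (measure_pmf (bernoulli_pmf (1 / 2))) {y j})"
    using assms by (intro emeasure_PiM_Collect) auto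
  also have "\<dots> = (\<Prod>j\<in>J. ennreal (1 / 2))"
  proof (rule prod.cong[OF refl])
    fix j show "emeasure (measure_pmf (bernoulli_pmf (1 / 2))) {y j} = ennreal (1 / 2)"
      by (cases "y j") (simp_all add: emeasure_pmf_single)
  qed
  also have "\<dots> = ennreal ((1 / 2) ^ card J)"
    by (subst prod_constant, subst ennreal_power) simp_all
  finally show ?thesis .
qed

section \<open>Cylinder probabilities along the chain\<close>

lemma law_L_cylinder:
  assumes \<mu>: "prob_space \<mu>" "sets \<mu> = sets line_space" and F: "finite F"
  shows "emeasure (law_L \<mu> p r) (cylinder F e) =
    emeasure (chain_law \<mu> p r) {x. \<forall>(i, t)\<in>F. x t i = e (i, t)}"
proof -
  interpret Ionescu_Tulcea "chain_kernel \<mu> p r" "\<lambda>_. line_space"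
    using \<mu> by (rule Ionescu_Tulcea_chain)
  have sets_chain: "sets (chain_law \<mu> p r) = sets (PiM UNIV (\<lambda>_. line_space))"
    unfolding chain_law_def by (rule PF.sets_lim)
  have sp: "space (chain_law \<mu> p r) = UNIV"
    using sets_eq_imp_space_eq[OF sets_chain] by (simp add: space_PiM)
  have "(\<lambda>x (i, t). x t i) \<in> measurable (PiM UNIV (\<lambda>_. line_space)) orientation_space"
    unfolding orientation_space_def
  proof (rule measurable_PiM_single')
    fix f :: "int \<times> nat"
    have "(\<lambda>x. x (snd f)) \<in> measurable (PiM UNIV (\<lambda>_. line_space)) line_space"
      by (rule measurable_component_singleton) simp
    moreover have "(\<lambda>z. z (fst f)) \<in> measurable line_space (count_space UNIV)"
      unfolding line_space_def by (rule measurable_component_singleton) simp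
    ultimately have "(\<lambda>x. x (snd f) (fst f)) \<in> measurable (PiM UNIV (\<lambda>_. line_space)) (count_space UNIV)"
      by (rule measurable_compose)
    then show "(\<lambda>x. (\<lambda>(i, t). x t i) f) \<in> measurable (PiM UNIV (\<lambda>_. line_space)) (count_space UNIV)"
      by (simp add: case_prod_beta)
  qed (auto simp: space_PiM)
  then have "(\<lambda>x (i, t). x t i) \<in> measurable (chain_law \<mu> p r) orientation_space"
    by (simp add: measurable_cong_sets[OF sets_chain refl])
  from emeasure_distr[OF this sets_cylinder[OF F]] show ?thesis
    unfolding law_L_def sp by (simp add: cylinder_def vimage_def case_prod_beta)
qed

lemma law_L_first_line:
  assumes \<mu>: "prob_space \<mu>" "sets \<mu> = sets line_space" and J: "finite J"
  shows "emeasure (law_L \<mu> p r) (cylinder (J \<times> {0}) e) =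
    emeasure \<mu> {z. \<forall>j\<in>J. z j = e (j, 0)}"
proof -
  interpret Ionescu_Tulcea "chain_kernel \<mu> p r" "\<lambda>_. line_space"
    using \<mu> by (rule Ionescu_Tulcea_chain)
  let ?B = "{z. \<forall>j\<in>J. z j = e (j, 0)}"
  let ?S = "space (PiM {0..<0} (\<lambda>_::nat. line_space))"
  \<comment> \<open>The total mass of the limit is read off at the empty set of coordinates, over
    which the cylinder is everything.\<close>
  have "prod_emb UNIV (\<lambda>_. line_space) {0..<0} ?S = UNIV"
    by (auto simp: prod_emb_def space_PiM)
  moreover have "emeasure (CI {0..<0}) ?S = 1"
    using prob_space.emeasure_space_1[OF PF.prob_space_P[of "{0..<0}"]] by (simp add: PF.space_P)
  ultimately have total: "emeasure PF.lim UNIV = 1"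
    using lim[of "{0..<0}" ?S] by simp
  have "emeasure PF.lim {x \<in> space (PiM UNIV (\<lambda>_. line_space)). restrict x {0..<0} \<in> ?S \<and> x 0 \<in> ?B}
    = emeasure \<mu> ?B * emeasure PF.lim {x \<in> space (PiM UNIV (\<lambda>_. line_space)). restrict x {0..<0} \<in> ?S}"
    using J by (intro emeasure_lim_step sets.top sets_line_cylinder) (simp_all add: chain_kernel_def)
  then show ?thesis
    using total J by (simp add: restrict_def law_L_cylinder[OF \<mu>] chain_law_def space_PiM)
qed

text \<open>The edges of \<open>F\<close> lie on lines up to \<open>t\<close>, so their cylinder is
  an event of the past. They include the upper edges of \<open>K\<close>, so on this event the
  transition probabilities at \<open>K\<close> are constant, as \<open>emeasure_lim_step\<close>
  requires.\<close>

lemma law_L_step: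
  assumes \<mu>: "prob_space \<mu>" "sets \<mu> = sets line_space"
    and F: "finite F" "snd ` F \<subseteq> {..t}" "pair_edges t K \<subseteq> F"
    and K: "finite K" "K \<subseteq> vertices_on_line t"
  shows "emeasure (law_L \<mu> p r) (cylinder (F \<union> pair_edges (Suc t) K) e) =
    ennreal (\<Prod>i\<in>K. pmf (local_transition p r (e (i, t), e (i + 1, t))) (e (i, Suc t), e (i + 1, Suc t)))
    * emeasure (law_L \<mu> p r) (cylinder F e)"
proof -
  interpret Ionescu_Tulcea "chain_kernel \<mu> p r" "\<lambda>_. line_space"
    using \<mu> by (rule Ionescu_Tulcea_chain)
  let ?M = "PiM {0..<Suc t} (\<lambda>_::nat. line_space)"
  let ?w = "\<lambda>i. (e (i, Suc t), e (i + 1, Suc t))"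
  let ?q = "\<Prod>i\<in>K. pmf (local_transition p r (e (i, t), e (i + 1, t))) (?w i)"
  define A where "A = {x \<in> space ?M. \<forall>f\<in>F. x (snd f) (fst f) = e f}"
  define B where "B = {z. \<forall>i\<in>K. (z i, z (i + 1)) = ?w i}"
  have "A \<in> sets ?M"
    unfolding A_def
  proof (rule sets.sets_Collect_finite_All[OF _ F(1)])
    fix f assume "f \<in> F"
    then have "(\<lambda>x. x (snd f)) \<in> measurable ?M line_space"
      using F(2) by (intro measurable_component_singleton) auto
    from measurable_sets[OF this sets_line_cylinder[of "{fst f}" "\<lambda>_. e f"]]
    show "{x \<in> space ?M. x (snd f) (fst f) = e f} \<in> sets ?M"
      by (simp add: vimage_def Int_def conj_commute)
  qed
  moreover have "B \<in> sets line_space"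
    unfolding B_def using K(1) by (rule sets_line_pairs)
  moreover have "emeasure (chain_kernel \<mu> p r (Suc t) x) B = ennreal ?q" if "x \<in> A" for x
  proof -
    have "x t i = e (i, t) \<and> x t (i + 1) = e (i + 1, t)" if "i \<in> K" for i
    proof -
      have "(i, t) \<in> F" "(i + 1, t) \<in> F"
        using F(3) that by (auto simp: pair_edges_def)
      then show ?thesis
        using \<open>x \<in> A\<close> unfolding A_def by fastforce
    qed
    then have "(\<Prod>i\<in>K. pmf (local_transition p r (x t i, x t (i + 1))) (?w i)) = ?q"
      by (intro prod.cong refl) simp
    moreover have "chain_kernel \<mu> p r (Suc t) x = line_kernel p r t (x t)"
      by (simp add: chain_kernel_def)
    ultimately show ?thesis
      unfolding B_def by (simp only: emeasure_line_kernel_pairs[OF K])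
  qed
  ultimately have "emeasure PF.lim
      {x \<in> space (PiM UNIV (\<lambda>_. line_space)). restrict x {0..<Suc t} \<in> A \<and> x (Suc t) \<in> B}
    = ennreal ?q * emeasure PF.lim
      {x \<in> space (PiM UNIV (\<lambda>_. line_space)). restrict x {0..<Suc t} \<in> A}"
    by (rule emeasure_lim_step)
  moreover have mem_A: "restrict x {0..<Suc t} \<in> A \<longleftrightarrow> (\<forall>(i, s)\<in>F. x s i = e (i, s))" for x
  proof -
    have "restrict x {0..<Suc t} s = x s" if "(i, s) \<in> F" for i s
      using F(2) that by force
    then show ?thesis
      by (auto simp: A_def space_PiM simp del: restrict_apply)
  qed
  moreover have "(\<forall>(i, s)\<in>F \<union> pair_edges (Suc t) K. x s i = e (i, s)) \<longleftrightarrow>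
      (\<forall>(i, s)\<in>F. x s i = e (i, s)) \<and> x (Suc t) \<in> B" for x
    by (auto simp: B_def pair_edges_def)
  ultimately show ?thesis
    using F(1) K(1) by (simp add: law_L_cylinder[OF \<mu>] chain_law_def space_PiM pair_edges_def)
qed

section \<open>Uniformity of each line\<close>

text \<open>Uniformity passes to fewer edges by releasing those of \<open>D\<close> one at a time:
  the two values of a released edge contribute equal masses. \<open>F\<close> varies in the
  induction because the edge \<open>k\<close> must join it before the hypothesis applies.\<close>

lemma uniform_cylinder_subset:
  assumes "finite D" "finite F" "D \<inter> F = {}" and L: "sets L = sets orientation_space"
    and "\<And>e. emeasure L (cylinder (F \<union> D) e) = ennreal ((1 / 2) ^ card (F \<union> D))"
  shows "emeasure L (cylinder F e) = ennreal ((1 / 2) ^ card F)"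
  using assms(1-3,5)
proof (induction D arbitrary: F e)
  case (insert k D)
  have half: "emeasure L (cylinder (insert k F) e) = ennreal ((1 / 2) ^ Suc (card F))" for e
    using insert.IH[of "insert k F" e] insert.prems insert.hyps by simp
  have split: "cylinder F e = cylinder (insert k F) (e(k := True)) \<union> cylinder (insert k F) (e(k := False))"
    using insert.prems(2) by (auto simp: cylinder_def)
  have "emeasure L (cylinder F e) =
      emeasure L (cylinder (insert k F) (e(k := True))) + emeasure L (cylinder (insert k F) (e(k := False)))"
    unfolding split using insert.prems(1) L
    by (intro plus_emeasure[symmetric]) (auto simp: sets_cylinder, auto simp: cylinder_def)
  then show ?case
    by (simp add: half ennreal_plus[symmetric] del: ennreal_plus)
qed simp

text \<open>Induction on the line: \<open>J\<close> is completed to whole pairs, the pairs above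
  them are summed out by double stochasticity, and the added edges are released again.\<close>

lemma law_L_line_uniform:
  assumes pr: "0 \<le> p" "p \<le> 1" "0 \<le> r" "r \<le> 1" and J: "finite J"
  shows "emeasure (law_L PM_half p r) (cylinder (J \<times> {t}) e) = ennreal ((1 / 2) ^ card J)"
  using J
proof (induction t arbitrary: J e)
  case 0
  then show ?case
    by (simp add: law_L_first_line[OF prob_space_PM_half sets_PM_half] emeasure_PM_half_cylinder)
next
  case (Suc t)
  let ?L = "law_L PM_half p r"
  \<comment> \<open>\<open>K\<close> collects the vertices of line \<open>t\<close> with a lower
    edge in \<open>J\<close>, and \<open>J'\<close> the positions of all their edges.\<close>
  define K where "K = {i \<in> vertices_on_line t. i \<in> J \<or> i + 1 \<in> J}"
  define J' where "J' = K \<union> (\<lambda>i. i + 1) ` K"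
  have "K \<subseteq> J \<union> (\<lambda>j. j - 1) ` J"
    by (force simp: K_def)
  then have K: "finite K" "K \<subseteq> vertices_on_line t"
    using Suc.prems by (auto simp: K_def intro: finite_subset)
  then have J': "finite J'" by (simp add: J'_def)
  have J_sub: "J \<subseteq> J'"
  proof
    fix j assume "j \<in> J"
    then have "j \<in> K \<or> j - 1 \<in> K"
      by (auto simp: K_def vertices_on_line_def)
    then show "j \<in> J'"
      by (force simp: J'_def)
  qed
  have sets_L: "sets ?L = sets orientation_space"
    by (simp add: law_L_def)
  have pair: "(line_of_pairs t g i, line_of_pairs t g (i + 1)) = g i" if "i \<in> K" for i g
    using that K(2) by (auto simp: vertices_on_line_def line_of_pairs_def)
  have uniform: "emeasure ?L (cylinder (J' \<times> {Suc t}) e) = ennreal ((1 / 2) ^ card J')" for e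
  proof -
    let ?G = "PiE K (\<lambda>_. UNIV :: (bool \<times> bool) set)"
    let ?F = "J' \<times> {t} \<union> pair_edges (Suc t) K"
    \<comment> \<open>On line \<open>t\<close>, \<open>e' g\<close> carries the upper pairs
      prescribed by \<open>g\<close>; elsewhere it agrees with \<open>e\<close>.\<close>
    define e' where "e' g = (\<lambda>(i, s). if s = t then line_of_pairs t g i else e (i, s))" for g
    define f where "f i q = pmf (local_transition p r q) (e (i, Suc t), e (i + 1, Suc t))" for i q
    have e'_t: "(e' g (i, t), e' g (i + 1, t)) = g i" if "i \<in> K" for g i
      using pair[OF that] by (simp add: e'_def)
    \<comment> \<open>The event is split according to the upper pairs \<open>g\<close> seen at the
      vertices of \<open>K\<close>.\<close>
    have union: "cylinder (J' \<times> {Suc t}) e = (\<Union>g\<in>?G. cylinder ?F (e' g))"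
    proof (intro equalityI subsetI)
      fix x assume x: "x \<in> cylinder (J' \<times> {Suc t}) e"
      define g where "g = (\<lambda>i\<in>K. (x (i, t), x (i + 1, t)))"
      have "x (i, t) = e' g (i, t) \<and> x (i + 1, t) = e' g (i + 1, t)" if "i \<in> K" for i
        using e'_t[OF that, of g] that by (simp add: g_def)
      then have "x \<in> cylinder ?F (e' g)"
        using x by (auto simp: cylinder_def pair_edges_def J'_def e'_def)
      moreover have "g \<in> ?G" by (simp add: g_def)
      ultimately show "x \<in> (\<Union>g\<in>?G. cylinder ?F (e' g))" by blast
    next
      fix x assume "x \<in> (\<Union>g\<in>?G. cylinder ?F (e' g))"
      then show "x \<in> cylinder (J' \<times> {Suc t}) e"
        by (auto simp: cylinder_def pair_edges_def J'_def e'_def)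
    qed
    \<comment> \<open>Distributivity turns the sum over all \<open>g\<close> into a product of
      column sums, each equal to \<open>1\<close>.\<close>
    have "(\<Sum>g\<in>?G. \<Prod>i\<in>K. f i (g i)) = (\<Prod>i\<in>K. \<Sum>q\<in>UNIV. f i q)"
      using K(1) by (intro prod_sum_PiE[symmetric]) auto
    also have "\<dots> = 1"
      unfolding f_def using pr by (simp add: local_transition_doubly_stochastic)
    finally have total: "(\<Sum>g\<in>?G. \<Prod>i\<in>K. f i (g i)) = 1" .
    have disj: "disjoint_family_on (\<lambda>g. cylinder ?F (e' g)) ?G"
      unfolding disjoint_family_on_def
    proof (intro ballI impI, rule ccontr)
      fix g g' assume g: "g \<in> ?G" "g' \<in> ?G" "g \<noteq> g'"
      assume "cylinder ?F (e' g) \<inter> cylinder ?F (e' g') \<noteq> {}"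
      then obtain x where x: "x \<in> cylinder ?F (e' g)" "x \<in> cylinder ?F (e' g')" by blast
      have "g i = g' i" if "i \<in> K" for i
      proof -
        have "(i, t) \<in> ?F" "(i + 1, t) \<in> ?F" using that by (auto simp: J'_def)
        then have "e' g (i, t) = e' g' (i, t)" "e' g (i + 1, t) = e' g' (i + 1, t)"
          using x unfolding cylinder_def by auto
        then have "(e' g (i, t), e' g (i + 1, t)) = (e' g' (i, t), e' g' (i + 1, t))"
          by (rule arg_cong2[where f=Pair])
        then show ?thesis unfolding e'_t[OF that] .
      qed
      then have "g = g'" using g(1,2) by (intro PiE_ext) auto
      with g(3) show False by simp
    qed
    have "finite ?F" using J' K by (simp add: pair_edges_def)
    then have sets: "(\<lambda>g. cylinder ?F (e' g)) ` ?G \<subseteq> sets ?L"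
      unfolding sets_L by (intro image_subsetI sets_cylinder)
    have "finite ?G" using K(1) by (intro finite_PiE) simp_all
    with sets disj have "emeasure ?L (cylinder (J' \<times> {Suc t}) e) = (\<Sum>g\<in>?G. emeasure ?L (cylinder ?F (e' g)))"
      unfolding union by (rule sum_emeasure[symmetric])
    also have "\<dots> = (\<Sum>g\<in>?G. ennreal ((\<Prod>i\<in>K. f i (g i)) * (1 / 2) ^ card J'))"
    proof (rule sum.cong[OF refl])
      fix g assume "g \<in> ?G"
      \<comment> \<open>With line \<open>t\<close> fixed on \<open>J'\<close>, the induction
        hypothesis gives each \<open>g\<close> the same mass
        \<open>(1 / 2) ^ card J'\<close>.\<close>
      have step: "emeasure ?L (cylinder ?F (e' g)) =
        ennreal (\<Prod>i\<in>K. pmf (local_transition p r (e' g (i, t), e' g (i + 1, t)))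
          (e' g (i, Suc t), e' g (i + 1, Suc t))) * emeasure ?L (cylinder (J' \<times> {t}) (e' g))"
        using J' K by (intro law_L_step prob_space_PM_half sets_PM_half)
          (simp_all add: pair_edges_def J'_def)
      have pmf: "(\<Prod>i\<in>K. pmf (local_transition p r (e' g (i, t), e' g (i + 1, t)))
          (e' g (i, Suc t), e' g (i + 1, Suc t))) = (\<Prod>i\<in>K. f i (g i))"
      proof (rule prod.cong[OF refl])
        fix i assume "i \<in> K"
        have "e' g (i, Suc t) = e (i, Suc t)" "e' g (i + 1, Suc t) = e (i + 1, Suc t)"
          by (simp_all add: e'_def)
        then show "pmf (local_transition p r (e' g (i, t), e' g (i + 1, t)))
            (e' g (i, Suc t), e' g (i + 1, Suc t)) = f i (g i)"
          unfolding f_def e'_t[OF \<open>i \<in> K\<close>] by (simp only:)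
      qed
      show "emeasure ?L (cylinder ?F (e' g)) = ennreal ((\<Prod>i\<in>K. f i (g i)) * (1 / 2) ^ card J')"
        unfolding step pmf Suc.IH[OF J']
        by (rule ennreal_mult[symmetric]) (simp_all add: f_def prod_nonneg)
    qed
    also have "\<dots> = ennreal ((\<Sum>g\<in>?G. \<Prod>i\<in>K. f i (g i)) * (1 / 2) ^ card J')"
      unfolding sum_distrib_right by (rule sum_ennreal) (simp add: f_def prod_nonneg)
    finally show ?thesis by (simp only: total mult_1)
  qed
  have un: "J \<times> {Suc t} \<union> (J' - J) \<times> {Suc t} = J' \<times> {Suc t}"
    using J_sub by auto
  have "emeasure ?L (cylinder (J \<times> {Suc t}) e) = ennreal ((1 / 2) ^ card (J \<times> {Suc t}))"
  proof (rule uniform_cylinder_subset)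
    show "finite ((J' - J) \<times> {Suc t})" "finite (J \<times> {Suc t})"
      using J' Suc.prems by simp_all
    show "emeasure ?L (cylinder (J \<times> {Suc t} \<union> (J' - J) \<times> {Suc t}) e) =
        ennreal ((1 / 2) ^ card (J \<times> {Suc t} \<union> (J' - J) \<times> {Suc t}))" for e
      unfolding un by (simp add: uniform card_cartesian_product)
  qed (use sets_L in auto)
  then show ?case by (simp add: card_cartesian_product)
qed

section \<open>Exposing the finite graph line by line\<close>

text \<open>The part of \<open>edges_K N\<close> on the lines \<open>0\<close> to \<open>n\<close>,
  for \<open>n\<close> at most \<open>N\<close>: the width stays tied to \<open>N\<close> while the
  depth \<open>n\<close> drives the induction.\<close>

definition first_lines_edges :: "nat \<Rightarrow> nat \<Rightarrow> (int \<times> nat) set" where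
  "first_lines_edges N n = {(i, 0) | i. 0 \<le> i \<and> i \<le> 2 * int N - 1} \<union>
     (\<Union>t<n. {(i, t + 1) | i. int t \<le> i \<and> i \<le> 2 * int N - 1 - int t})"

definition line_vertices :: "nat \<Rightarrow> nat \<Rightarrow> int set" where
  "line_vertices N t = {i. int t \<le> i \<and> i \<le> 2 * int N - 2 - int t \<and> even (i + int t)}"

definition translate :: "int \<Rightarrow> nat \<Rightarrow> int \<times> nat \<Rightarrow> int \<times> nat" where
  "translate i\<^sub>0 t\<^sub>0 = (\<lambda>(i, t). (i\<^sub>0 + i, t\<^sub>0 + t))"

lemma finite_line_vertices: "finite (line_vertices N t)"
  by (rule finite_subset[of _ "{int t..2 * int N - 2 - int t}"]) (auto simp: line_vertices_def)

lemma finite_first_lines_edges: "finite (first_lines_edges N n)"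
proof (rule finite_subset)
  show "first_lines_edges N n \<subseteq> {0..2 * int N} \<times> {..n}"
    by (auto simp: first_lines_edges_def)
qed simp

lemma edges_K_eq: "edges_K N = first_lines_edges N N"
  by (simp add: edges_K_def first_lines_edges_def)

lemma first_lines_edges_Suc:
  assumes "n < N"
  shows "first_lines_edges N (Suc n) = first_lines_edges N n \<union> pair_edges (Suc n) (line_vertices N n)"
proof -
  have "{(i, n + 1) | i. int n \<le> i \<and> i \<le> 2 * int N - 1 - int n} =
      pair_edges (Suc n) (line_vertices N n)"
  proof (intro equalityI subsetI)
    fix f assume "f \<in> {(i, n + 1) | i. int n \<le> i \<and> i \<le> 2 * int N - 1 - int n}"
    then obtain i where i: "f = (i, Suc n)" "int n \<le> i" "i \<le> 2 * int N - 1 - int n"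
      by auto
    \<comment> \<open>The interval of positions starts at the parity of \<open>n\<close> and ends at
      the opposite one, so it is tiled by the pairs: \<open>i\<close> is a left or a right lower
      edge according to its parity.\<close>
    have "i \<in> line_vertices N n \<or> i - 1 \<in> line_vertices N n"
      using i(2,3) unfolding line_vertices_def mem_Collect_eq by presburger
    then show "f \<in> pair_edges (Suc n) (line_vertices N n)"
      using i(1) by (force simp: pair_edges_def)
  qed (auto simp: pair_edges_def line_vertices_def)
  then show ?thesis
    by (auto simp: first_lines_edges_def lessThan_Suc)
qed

text \<open>Below the top line, line \<open>n\<close> extends one edge beyond the upper edges of row
  \<open>n\<close> at either end.\<close>

lemma pair_edges_subset_first_lines:
  "pair_edges n (line_vertices N n) \<subseteq> first_lines_edges N n"
proof (cases n)
  case 0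
  then show ?thesis
    by (auto simp: pair_edges_def line_vertices_def first_lines_edges_def)
next
  case (Suc m)
  then have "(i, n) \<in> first_lines_edges N n" if "int m \<le> i" "i \<le> 2 * int N - 1 - int m" for i
    using that by (auto simp: first_lines_edges_def)
  with Suc show ?thesis
    by (auto simp: pair_edges_def line_vertices_def)
qed

lemma translate_pair_edges:
  "translate i\<^sub>0 t\<^sub>0 ` pair_edges t K = pair_edges (t\<^sub>0 + t) ((+) i\<^sub>0 ` K)"
  by (force simp: translate_def pair_edges_def image_iff)

text \<open>The top line of the copy gives \<open>2 * N\<close> uniform edges by
  \<open>law_L_line_uniform\<close>; each row of vertices then adds its factor by
  \<open>law_L_step\<close>.\<close>

lemma law_L_first_lines:
  assumes pr: "0 \<le> p" "p \<le> 1" "0 \<le> r" "r \<le> 1" and even: "even (i\<^sub>0 + int t\<^sub>0)" and "n \<le> N"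
  shows "emeasure (law_L PM_half p r) (cylinder (translate i\<^sub>0 t\<^sub>0 ` first_lines_edges N n) e) =
    ennreal ((1 / 2) ^ (2 * N) * (\<Prod>t<n. \<Prod>i\<in>line_vertices N t. pmf
      (local_transition p r (e (i\<^sub>0 + i, t\<^sub>0 + t), e (i\<^sub>0 + i + 1, t\<^sub>0 + t)))
      (e (i\<^sub>0 + i, t\<^sub>0 + t + 1), e (i\<^sub>0 + i + 1, t\<^sub>0 + t + 1))))"
  using \<open>n \<le> N\<close>
proof (induction n)
  case 0
  have "translate i\<^sub>0 t\<^sub>0 ` first_lines_edges N 0 = {i\<^sub>0..i\<^sub>0 + 2 * int N - 1} \<times> {t\<^sub>0}"
  proof (intro equalityI subsetI)
    fix f assume "f \<in> {i\<^sub>0..i\<^sub>0 + 2 * int N - 1} \<times> {t\<^sub>0}"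
    then have "f = translate i\<^sub>0 t\<^sub>0 (fst f - i\<^sub>0, 0)" "(fst f - i\<^sub>0, 0) \<in> first_lines_edges N 0"
      by (auto simp: translate_def first_lines_edges_def)
    then show "f \<in> translate i\<^sub>0 t\<^sub>0 ` first_lines_edges N 0"
      by (rule image_eqI)
  qed (auto simp: translate_def first_lines_edges_def)
  then show ?case
    by (simp add: law_L_line_uniform[OF pr] nat_mult_distrib)
next
  case (Suc n)
  let ?K = "(+) i\<^sub>0 ` line_vertices N n"
  \<comment> \<open>The parity of \<open>i\<^sub>0 + int t\<^sub>0\<close> makes the translated row
    consist of vertices of the infinite graph.\<close>
  have K: "finite ?K" "?K \<subseteq> vertices_on_line (t\<^sub>0 + n)"
    using even finite_line_vertices by (auto simp: line_vertices_def vertices_on_line_def)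
  have F: "finite (translate i\<^sub>0 t\<^sub>0 ` first_lines_edges N n)"
    "snd ` translate i\<^sub>0 t\<^sub>0 ` first_lines_edges N n \<subseteq> {..t\<^sub>0 + n}"
    "pair_edges (t\<^sub>0 + n) ?K \<subseteq> translate i\<^sub>0 t\<^sub>0 ` first_lines_edges N n"
    unfolding translate_pair_edges[symmetric]
    by (auto simp: finite_first_lines_edges intro!: image_mono pair_edges_subset_first_lines)
       (auto simp: first_lines_edges_def translate_def)
  have "translate i\<^sub>0 t\<^sub>0 ` first_lines_edges N (Suc n) =
      translate i\<^sub>0 t\<^sub>0 ` first_lines_edges N n \<union> pair_edges (Suc (t\<^sub>0 + n)) ?K"
    using Suc.prems by (simp add: first_lines_edges_Suc image_Un translate_pair_edges)
  then show ?case
    using Suc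
    by (simp add: law_L_step[OF prob_space_PM_half sets_PM_half F K] prod.reindex prod_nonneg
      ennreal_mult[symmetric] mult_ac)
qed

section \<open>Comparison with the 8-vertex measure\<close>

lemma vertices_K_eq: "vertices_K N = (\<Union>t<N. (\<lambda>i. (i, t)) ` line_vertices N t)"
  by (auto simp: vertices_K_def line_vertices_def)

lemma prod_vertices_K: "(\<Prod>v\<in>vertices_K N. f v) = (\<Prod>t<N. \<Prod>i\<in>line_vertices N t. f (i, t))"
  unfolding vertices_K_eq
  by (subst prod.UNION_disjoint) (auto simp: finite_line_vertices prod.reindex inj_on_def)

lemma weight8_nonneg:
  assumes "a \<ge> 0" "b \<ge> 0" "c \<ge> 0" "d \<ge> 0"
  shows "0 \<le> weight8 a b c d N e"
  unfolding weight8_def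
proof (rule prod_nonneg, safe)
  fix i t show "0 \<le> local_weight a b c d e (i, t)"
    using assms by (simp add: local_weight_if)
qed

text \<open>A vertex with an odd number of incoming edges contributes a zero factor. Sums of weights
  over all orientations thus reduce to sums over \<open>Omega8 N\<close>.\<close>

lemma weight8_outside_Omega8:
  assumes "e \<in> orientations_K N" "e \<notin> Omega8 N"
  shows "weight8 a b c d N e = 0"
proof -
  obtain i t where v: "(i, t) \<in> vertices_K N" "odd (card (incoming_edges e (i, t)))"
    using assms by (auto simp: Omega8_def)
  have "finite (vertices_K N)"
    by (simp add: vertices_K_eq finite_line_vertices)
  with v local_weight_odd[OF v(2)] show ?thesis
    unfolding weight8_def by (intro prod_zero bexI[of _ "(i, t)"]) auto
qed

lemma finite_orientations_K: "finite (orientations_K N)"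
  unfolding orientations_K_def edges_K_eq
  by (intro finite_PiE finite_first_lines_edges) simp

theorem proposition1p3:
  fixes a b c d :: real
    and M :: "'w measure"
    and X :: "'w \<Rightarrow> int \<times> nat \<Rightarrow> bool"
    and N t\<^sub>0 :: nat
    and i\<^sub>0 :: int
  assumes "a \<ge> 0" and "b \<ge> 0" and "c \<ge> 0" and "d \<ge> 0"
    and "\<not> (a = 0 \<and> b = 0 \<and> c = 0 \<and> d = 0)"
    and "a + c = b + d"
    and "prob_space M"
    and "X \<in> measurable M orientation_space"
    and "distr M orientation_space X = law_L PM_half (a / (a + c)) (b / (b + d))"
    and "N \<ge> 1"
    and "even (i\<^sub>0 + int t\<^sub>0)"
  shows "distr M (count_space (orientations_K N)) (\<lambda>\<omega>. restrict_to_copy N i\<^sub>0 t\<^sub>0 (X \<omega>))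
    = P8 a b c d N"
proof -
  interpret prob_space M by fact
  let ?p = "a / (a + c)" and ?r = "b / (b + d)"
  let ?R = "\<lambda>\<omega>. restrict_to_copy N i\<^sub>0 t\<^sub>0 (X \<omega>)"
  let ?D = "distr M (count_space (orientations_K N)) ?R"
  let ?F = "translate i\<^sub>0 t\<^sub>0 ` first_lines_edges N N"
  have pos: "a + c > 0"
    using assms(1-6) by linarith
  have pr: "0 \<le> ?p" "?p \<le> 1" "0 \<le> ?r" "?r \<le> 1"
    using assms(1-6) pos by simp_all
  \<comment> \<open>The power of \<open>1 / 2\<close> comes from the uniform top line, and each
    vertex gives one factor \<open>1 / (a + c)\<close> when its weight becomes a
    probability.\<close>
  define Z where "Z = (1 / 2) ^ (2 * N) * (1 / (a + c)) ^ card (vertices_K N)"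
  have Z: "Z > 0"
    using pos by (simp add: Z_def)
  have R_in: "restrict_to_copy N i\<^sub>0 t\<^sub>0 x \<in> orientations_K N" for x
    by (auto simp: restrict_to_copy_def orientations_K_def)
  \<comment> \<open>Elements of \<open>orientations_K N\<close> are determined by their values on
    \<open>edges_K N\<close>. The natural subtraction \<open>t - t\<^sub>0\<close> is exact on the
    translated edges.\<close>
  have R_iff: "restrict_to_copy N i\<^sub>0 t\<^sub>0 x = e \<longleftrightarrow>
      x \<in> cylinder ?F (\<lambda>(i, t). e (i - i\<^sub>0, t - t\<^sub>0))" if "e \<in> orientations_K N" for e x
  proof -
    have "restrict_to_copy N i\<^sub>0 t\<^sub>0 x = e \<longleftrightarrow> (\<forall>f\<in>edges_K N. restrict_to_copy N i\<^sub>0 t\<^sub>0 x f = e f)"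
      using R_in[of x] that unfolding orientations_K_def by (auto intro: PiE_ext)
    also have "\<dots> \<longleftrightarrow> (\<forall>(i, t)\<in>edges_K N. x (i\<^sub>0 + i, t\<^sub>0 + t) = e (i, t))"
      by (auto simp: restrict_to_copy_def)
    also have "\<dots> \<longleftrightarrow> x \<in> cylinder ?F (\<lambda>(i, t). e (i - i\<^sub>0, t - t\<^sub>0))"
      by (simp add: edges_K_eq cylinder_def translate_def case_prod_beta)
    finally show ?thesis .
  qed
  have vimage: "?R -` {e} \<inter> space M = X -` cylinder ?F (\<lambda>(i, t). e (i - i\<^sub>0, t - t\<^sub>0)) \<inter> space M"
    if "e \<in> orientations_K N" for e
    using R_iff[OF that] by auto
  have cyl: "cylinder ?F e \<in> sets orientation_space" for e
    by (intro sets_cylinder finite_imageI finite_first_lines_edges)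
  \<comment> \<open>The target is finite, so it suffices that preimages of singletons, which are
    cylinder events, are measurable.\<close>
  have R_meas: "?R \<in> measurable M (count_space (orientations_K N))"
    using measurable_sets[OF assms(8) cyl] R_in
    by (subst measurable_count_space_eq_countable)
       (auto simp: vimage countable_finite finite_orientations_K)
  have singleton: "emeasure ?D {e} = ennreal (Z * weight8 a b c d N e)" if e: "e \<in> orientations_K N" for e
  proof -
    let ?e = "\<lambda>(i, t). e (i - i\<^sub>0, t - t\<^sub>0)"
    have "emeasure ?D {e} = emeasure M (?R -` {e} \<inter> space M)"
      using e by (intro emeasure_distr[OF R_meas]) simp
    also have "\<dots> = emeasure (distr M orientation_space X) (cylinder ?F ?e)"
      unfolding vimage[OF e] by (rule emeasure_distr[symmetric, OF assms(8) cyl])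
    also have "\<dots> = ennreal ((1 / 2) ^ (2 * N) * (\<Prod>(i, t)\<in>vertices_K N. pmf
        (local_transition ?p ?r (e (i, t), e (i + 1, t))) (e (i, t + 1), e (i + 1, t + 1))))"
      unfolding assms(9) law_L_first_lines[OF pr assms(11) order.refl] prod_vertices_K
      by (simp add: algebra_simps)
    also have "(\<Prod>(i, t)\<in>vertices_K N. pmf
        (local_transition ?p ?r (e (i, t), e (i + 1, t))) (e (i, t + 1), e (i + 1, t + 1)))
      = (\<Prod>v\<in>vertices_K N. 1 / (a + c) * local_weight a b c d e v)"
      using pos by (intro prod.cong refl) (auto simp: local_weight_eq_pmf[OF assms(1-4,6) pos])
    finally show ?thesis
      by (simp only: prod.distrib prod_constant weight8_def Z_def mult.assoc)
  qed
  \<comment> \<open>The image law has total mass \<open>1\<close>, which identifies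
    \<open>1 / Z\<close> as the partition function.\<close>
  have "Z * (\<Sum>e\<in>Omega8 N. weight8 a b c d N e) = 1"
  proof -
    have "1 = emeasure ?D (orientations_K N)"
      using prob_space.emeasure_space_1[OF prob_space_distr[OF R_meas]] by simp
    also have "\<dots> = (\<Sum>e\<in>orientations_K N. emeasure ?D {e})"
      by (intro emeasure_eq_sum_singleton finite_orientations_K) simp
    also have "\<dots> = ennreal (\<Sum>e\<in>orientations_K N. Z * weight8 a b c d N e)"
      using Z weight8_nonneg[OF assms(1-4)] by (simp add: singleton sum_ennreal)
    also have "(\<Sum>e\<in>orientations_K N. Z * weight8 a b c d N e) = (\<Sum>e\<in>Omega8 N. Z * weight8 a b c d N e)"
      using weight8_outside_Omega8
      by (intro sum.mono_neutral_right finite_orientations_K) (auto simp: Omega8_def)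
    finally show ?thesis
      by (simp add: sum_distrib_left)
  qed
  then have "(\<Sum>e\<in>Omega8 N. weight8 a b c d N e) = 1 / Z"
    using Z by (simp add: field_simps)
  then have prob8: "prob8 a b c d N e = Z * weight8 a b c d N e" for e
    by (simp add: prob8_def)
  show ?thesis
  proof (rule measure_eqI_finite[OF _ _ finite_orientations_K])
    fix e assume e: "e \<in> orientations_K N"
    then show "emeasure ?D {e} = emeasure (P8 a b c d N) {e}"
      by (auto simp: singleton P8_def emeasure_point_measure_finite finite_orientations_K prob8
        weight8_outside_Omega8)
  qed (simp_all add: P8_def sets_point_measure)
qed

end
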